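(* Let $\Gamma=(V,E)$ be a reflective antipodal invariant stratification graph with respect to a reference vertex $o$, with strata $V_0=\{o\},\dots,V_d=\{o'\}$ ($d\ge1$), adjacency matrix $A$, associated polynomials $P_0,\dots,P_d$ and eigenvalues $a_0,\dots,a_d$ of $A$ on the stratification subspace $K'$. Then $P_d(A)^2$ restricts to the identity on $K'$; consequently $P_d(a_k)\in\{1,-1\}$ for all $k=0,\dots,d$, and there exist a real polynomial $f$ and a time $t^*>0$ such that in the state $e^{-if(A)t^*}|o\rangle$ the qubits at $o$ and at its antipode $o'$ are maximally entangled, i.e. their entanglement is $C=1$.
   Context: Graphs are finite, simple and connected; $\partial(x,y)$ is the graph distance. The one-particle space is $K=\mathbb{C}^V$ with orthonormal basis $|k\rangle$, $k\in V$ (the state with the qubit at $k$ up and all others down), and the adjacency matrix $A$ acts on it. For a reference vertex $o$, the strata are $V_i=\{y\in V:\partial(o,y)=i\}$, $0\le i\le d$, where $d$ is the largest distance from $o$; $n_i=|V_i|$; the stratum states are $|\phi_i\rangle=\frac{1}{\sqrt{n_i}}\sum_{k\in V_i}|k\rangle$. $\Gamma$ is an invariant stratification graph (I.S.G.) with respect to $o$ if the stratification subspace $K'=\mathrm{span}\{|\phi_0\rangle,\dots,|\phi_d\rangle\}$ is invariant under $A$. In that case there are Szegő–Jacobi coefficients $\omega_1,\dots,\omega_d>0$ and $\alpha_0,\dots,\alpha_d$ with $$A|\phi_i\rangle=\sqrt{\omega_{i+1}}\,|\phi_{i+1}\rangle+\alpha_i|\phi_i\rangle+\sqrt{\omega_i}\,|\phi_{i-1}\rangle,\qquad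 0\le i\le d,$$ where the terms with $|\phi_{-1}\rangle$ and $|\phi_{d+1}\rangle$ are absent. Define $\widetilde P_0(x)=1$, $\widetilde P_1(x)=x-\alpha_0$, $x\widetilde P_i(x)=\widetilde P_{i+1}(x)+\alpha_i\widetilde P_i(x)+\omega_i\widetilde P_{i-1}(x)$ for $1\le i\le d$, and $P_i=\widetilde P_i/\sqrt{\omega_1\cdots\omega_i}$ for $0\le i\le d$; then $|\phi_i\rangle=P_i(A)|\phi_0\rangle$. The numbers $a_0,\dots,a_d$ are the distinct real roots of $\widetilde P_{d+1}$, i.e. the eigenvalues of $A$ restricted to $K'$. The I.S.G. is antipodal if the last stratum is a single vertex, $V_d=\{o'\}$; $o'$ is the antipode of $o$. An antipodal I.S.G. is also an I.S.G. with respect to $o'$, with $d$ the largest distance from $o'$ as well; let $\omega_i'$, $\alpha_i'$ be the Szegő–Jacobi coefficients for the stratification around $o'$. The antipodal I.S.G. is called reflective if $\omega_i'=\omega_i$ ($1\le i\le d$) and $\alpha_i'=\alpha_i$ ($0\le i\le d$). In a one-particle state $\sum_k\upsilon_k|k\rangle$ the entanglement (concurrence) between the qubits at distinct vertices $m,n$ is $C_{mn}=2|\upsilon_m\upsilon_n|$. *)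

theory Defs
  imports "HOL-Analysis.Analysis" "HOL-Computational_Algebra.Polynomial"
begin

subsection \<open>Finite simple connected graphs on a finite vertex type\<close>

definition simple_connected_graph :: "('v::finite \<Rightarrow> 'v \<Rightarrow> bool) \<Rightarrow> bool" where
  "simple_connected_graph E \<longleftrightarrow> symp E \<and> irreflp E \<and> (\<forall>x y. E\<^sup>*\<^sup>* x y)"

definition graph_dist :: "('v \<Rightarrow> 'v \<Rightarrow> bool) \<Rightarrow> 'v \<Rightarrow> 'v \<Rightarrow> nat" where
  "graph_dist E x y = (LEAST n. (E ^^ n) x y)"

definition adjacency_matrix :: "('v::finite \<Rightarrow> 'v \<Rightarrow> bool) \<Rightarrow> complex^'v^'v" where
  "adjacency_matrix E = (\<chi> x y. if E x y then 1 else 0)"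

subsection \<open>Stratification\<close>

definition stratum :: "('v \<Rightarrow> 'v \<Rightarrow> bool) \<Rightarrow> 'v \<Rightarrow> nat \<Rightarrow> 'v set" where
  "stratum E u i = {y. graph_dist E u y = i}"

definition largest_dist :: "('v::finite \<Rightarrow> 'v \<Rightarrow> bool) \<Rightarrow> 'v \<Rightarrow> nat" where
  "largest_dist E u = Max (range (graph_dist E u))"

abbreviation ket :: "'v::finite \<Rightarrow> complex^'v" where
  "ket k \<equiv> axis k 1"

definition stratum_state :: "('v::finite \<Rightarrow> 'v \<Rightarrow> bool) \<Rightarrow> 'v \<Rightarrow> nat \<Rightarrow> complex^'v" where
  "stratum_state E u i =
     complex_of_real (1 / sqrt (real (card (stratum E u i)))) *s (\<Sum>k\<in>stratum E u i. ket k)"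

text \<open>The span is over the complex numbers, hence \<^const>\<open>vec.span\<close> and not \<^const>\<open>span\<close>.\<close>

definition strat_space :: "('v::finite \<Rightarrow> 'v \<Rightarrow> bool) \<Rightarrow> 'v \<Rightarrow> (complex^'v) set" where
  "strat_space E u = vec.span (stratum_state E u ` {0..largest_dist E u})"

definition isg :: "('v::finite \<Rightarrow> 'v \<Rightarrow> bool) \<Rightarrow> 'v \<Rightarrow> bool" where
  "isg E u \<longleftrightarrow> simple_connected_graph E \<and>
     (\<forall>v\<in>strat_space E u. adjacency_matrix E *v v \<in> strat_space E u)"

definition antipodal_isg :: "('v::finite \<Rightarrow> 'v \<Rightarrow> bool) \<Rightarrow> 'v \<Rightarrow> 'v \<Rightarrow> bool" where
  "antipodal_isg E u u' \<longleftrightarrow> isg E u \<and> stratum E u (largest_dist E u) = {u'}"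

subsection \<open>Szego--Jacobi coefficients and associated polynomials\<close>

text \<open>Only \<open>\<omega> i\<close> with \<open>1 \<le> i \<le> d\<close> and \<open>\<alpha> i\<close> with \<open>i \<le> d\<close> are constrained, where \<open>d\<close> is the
  largest distance from the reference vertex.\<close>

definition szego_jacobi ::
  "('v::finite \<Rightarrow> 'v \<Rightarrow> bool) \<Rightarrow> 'v \<Rightarrow> (nat \<Rightarrow> real) \<Rightarrow> (nat \<Rightarrow> real) \<Rightarrow> bool" where
  "szego_jacobi E u \<omega> \<alpha> \<longleftrightarrow>
     (\<forall>i\<in>{1..largest_dist E u}. 0 < \<omega> i) \<and>
     (\<forall>i\<in>{0..largest_dist E u}.
        adjacency_matrix E *v stratum_state E u i =
          (if i < largest_dist E u
           then complex_of_real (sqrt (\<omega> (i + 1))) *s stratum_state E u (i + 1) else 0) +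
          complex_of_real (\<alpha> i) *s stratum_state E u i +
          (if 0 < i
           then complex_of_real (sqrt (\<omega> i)) *s stratum_state E u (i - 1) else 0))"

text \<open>\<open>\<omega>\<close>, \<open>\<alpha>\<close> are the coefficients around \<open>u\<close> and \<open>\<omega>'\<close>, \<open>\<alpha>'\<close> those around the antipode \<open>u'\<close>.\<close>

definition reflective_antipodal_isg ::
  "('v::finite \<Rightarrow> 'v \<Rightarrow> bool) \<Rightarrow> 'v \<Rightarrow> 'v \<Rightarrow>
   (nat \<Rightarrow> real) \<Rightarrow> (nat \<Rightarrow> real) \<Rightarrow> (nat \<Rightarrow> real) \<Rightarrow> (nat \<Rightarrow> real) \<Rightarrow> bool" where
  "reflective_antipodal_isg E u u' \<omega> \<alpha> \<omega>' \<alpha>' \<longleftrightarrow>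
     antipodal_isg E u u' \<and>
     szego_jacobi E u \<omega> \<alpha> \<and> szego_jacobi E u' \<omega>' \<alpha>' \<and>
     (\<forall>i\<in>{1..largest_dist E u}. \<omega>' i = \<omega> i) \<and>
     (\<forall>i\<in>{0..largest_dist E u}. \<alpha>' i = \<alpha> i)"

fun monic_poly :: "(nat \<Rightarrow> real) \<Rightarrow> (nat \<Rightarrow> real) \<Rightarrow> nat \<Rightarrow> real poly" where
  "monic_poly \<omega> \<alpha> 0 = 1"
| "monic_poly \<omega> \<alpha> (Suc 0) = [:- \<alpha> 0, 1:]"
| "monic_poly \<omega> \<alpha> (Suc (Suc i)) =
     [:- \<alpha> (Suc i), 1:] * monic_poly \<omega> \<alpha> (Suc i) - smult (\<omega> (Suc i)) (monic_poly \<omega> \<alpha> i)"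

definition normalized_poly :: "(nat \<Rightarrow> real) \<Rightarrow> (nat \<Rightarrow> real) \<Rightarrow> nat \<Rightarrow> real poly" where
  "normalized_poly \<omega> \<alpha> i = smult (1 / sqrt (\<Prod>j=1..i. \<omega> j)) (monic_poly \<omega> \<alpha> i)"

definition is_eigenvalue_on :: "complex^'v^'v \<Rightarrow> (complex^'v) set \<Rightarrow> complex \<Rightarrow> bool" where
  "is_eigenvalue_on M S c \<longleftrightarrow> (\<exists>v\<in>S. v \<noteq> 0 \<and> M *v v = c *s v)"

subsection \<open>Functions of a matrix\<close>

text \<open>The operations \<open>*\<close> and \<open>^\<close> on the type of matrices act entrywise; powers with respect
  to \<open>**\<close> have to be introduced.\<close>

primrec matrix_power :: "complex^'v^'v \<Rightarrow> nat \<Rightarrow> complex^'v^'v" where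
  "matrix_power M 0 = mat 1"
| "matrix_power M (Suc n) = M ** matrix_power M n"

definition matrix_poly :: "real poly \<Rightarrow> complex^'v^'v \<Rightarrow> complex^'v^'v" where
  "matrix_poly p M = (\<Sum>i\<le>degree p. coeff p i *\<^sub>R matrix_power M i)"

definition matrix_exp :: "complex^'v^'v \<Rightarrow> complex^'v^'v" where
  "matrix_exp M = (\<Sum>n. (1 / fact n) *\<^sub>R matrix_power M n)"

subsection \<open>Entanglement in one-particle states\<close>

definition concurrence :: "complex^'v \<Rightarrow> 'v \<Rightarrow> 'v \<Rightarrow> real" where
  "concurrence \<upsilon> m n = 2 * cmod (\<upsilon> $ m * \<upsilon> $ n)"

end

(* Positivity of the omega_i gives every vertex of a stratum V_i with i < d a neighbour in V_(i+1).
   Hence every y lies on a geodesic from u to u', and the strata around u' are those around u in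
   reverse order. If both stratifications have the same Szego--Jacobi coefficients, then
   phi_i = P_i(A) phi_0 and phi_(d-i) = P_i(A) phi_d, so R = P_d(A) exchanges phi_0 and phi_d;
   since R commutes with P_i(A), it squares to the identity on every phi_i.
   An involution satisfies exp(-i t R) = cos t - i sin t R, so f = P_d and t = pi/4 work. *)

theory Submission
  imports Defs
begin

section \<open>Matrix polynomials\<close>

lemma scaleR_matrix_vector_mult:
  fixes M :: "complex^'n^'m"
  shows "(r *\<^sub>R M) *v x = r *\<^sub>R (M *v x)"
  by (simp add: vec_eq_iff matrix_vector_mult_def scaleR_sum_right)

lemma matrix_vector_mult_scaleR_right:
  fixes M :: "complex^'n^'m"
  shows "M *v (r *\<^sub>R x) = r *\<^sub>R (M *v x)"
  by (simp add: vec_eq_iff matrix_vector_mult_def scaleR_sum_right)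

lemma sum_matrix_vector_mult:
  fixes M :: "'i \<Rightarrow> complex^'n^'m"
  shows "(\<Sum>i\<in>I. M i) *v x = (\<Sum>i\<in>I. M i *v x)"
  by (induction I rule: infinite_finite_induct) (simp_all add: matrix_vector_mult_add_rdistrib)

text \<open>The definitions scale vectors by embedded reals through \<open>*s\<close>, while the
  calculus of real polynomials below uses \<open>*\<^sub>R\<close>; this translates between the
  two.\<close>

lemma of_real_smult_vec: "complex_of_real r *s (x :: complex^'n) = r *\<^sub>R x"
  by (simp add: vec_eq_iff scaleR_conv_of_real[where 'a = complex])

text \<open>Padding with zero coefficients gives polynomials of different degrees a common summation
  range.\<close>

lemma matrix_poly_alt:
  assumes "degree p \<le> n"
  shows "matrix_poly p M = (\<Sum>i\<le>n. coeff p i *\<^sub>R matrix_power M i)"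
  unfolding matrix_poly_def
  using assms by (intro sum.mono_neutral_left) (auto simp: coeff_eq_0)

lemma matrix_poly_vec_alt:
  assumes "degree p \<le> n"
  shows "matrix_poly p M *v x = (\<Sum>i\<le>n. coeff p i *\<^sub>R (matrix_power M i *v x))"
  by (simp add: matrix_poly_alt[OF assms] sum_matrix_vector_mult scaleR_matrix_vector_mult)

lemma matrix_poly_0: "matrix_poly 0 M *v x = 0"
  by (simp add: matrix_poly_def)

lemma matrix_poly_add:
  "matrix_poly (p + q) M *v x = matrix_poly p M *v x + matrix_poly q M *v x"
proof -
  define n where "n = max (degree p) (degree q)"
  have "degree p \<le> n" "degree q \<le> n" "degree (p + q) \<le> n"
    by (simp_all add: n_def degree_add_le)
  then show ?thesis
    by (simp add: matrix_poly_vec_alt scaleR_add_left sum.distrib)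
qed

lemma matrix_poly_smult: "matrix_poly (smult c p) M *v x = c *\<^sub>R (matrix_poly p M *v x)"
  using matrix_poly_vec_alt[of "smult c p" "degree p" M x] matrix_poly_vec_alt[of p "degree p" M x]
  by (simp add: degree_smult_le scaleR_sum_right)

lemma matrix_poly_diff:
  "matrix_poly (p - q) M *v x = matrix_poly p M *v x - matrix_poly q M *v x"
  using matrix_poly_add[of p "smult (-1) q" M x] matrix_poly_smult[of "-1" q M x] by simp

text \<open>Horner's rule: it turns \<open>pCons\<close> induction on the polynomial into repeated
  application of the matrix.\<close>

lemma matrix_poly_pCons:
  "matrix_poly (pCons a p) M *v x = a *\<^sub>R x + M *v (matrix_poly p M *v x)"
proof -
  have "matrix_poly (pCons a p) M *v x
      = (\<Sum>i\<le>Suc (degree p). coeff (pCons a p) i *\<^sub>R (matrix_power M i *v x))"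
    by (rule matrix_poly_vec_alt) (simp add: degree_pCons_le)
  also have "\<dots> = a *\<^sub>R x + (\<Sum>i\<le>degree p. coeff p i *\<^sub>R (M *v (matrix_power M i *v x)))"
    by (simp add: sum.atMost_Suc_shift matrix_vector_mul_assoc del: sum.atMost_Suc)
  also have "(\<Sum>i\<le>degree p. coeff p i *\<^sub>R (M *v (matrix_power M i *v x)))
      = M *v (matrix_poly p M *v x)"
    by (simp add: matrix_poly_vec_alt[of p "degree p"] matrix_vector_mult_scaleR_right
        vec.linear_sum[OF matrix_vector_mul_linear_gen])
  finally show ?thesis .
qed

text \<open>Any two polynomials in the same matrix therefore commute, because polynomial
  multiplication does.\<close>

lemma matrix_poly_mult:
  "matrix_poly (p * q) M *v x = matrix_poly p M *v (matrix_poly q M *v x)"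
  by (induction p)
    (simp_all add: matrix_poly_0 mult_pCons_left matrix_poly_add matrix_poly_smult matrix_poly_pCons)

lemma matrix_poly_eigenvector:
  assumes "M *v x = complex_of_real a *s x"
  shows "matrix_poly p M *v x = poly p a *\<^sub>R x"
  using assms
  by (induction p)
    (simp_all add: matrix_poly_0 matrix_poly_pCons of_real_smult_vec matrix_vector_mult_scaleR_right
      algebra_simps)

section \<open>The matrix exponential on eigenvectors\<close>

lemma bounded_bilinear_matrix_matrix_mult:
  "bounded_bilinear ((**) :: complex^'n^'n \<Rightarrow> complex^'n^'n \<Rightarrow> complex^'n^'n)"
proof -
  have add: "(A + B) ** C = A ** C + B ** C" for A B C :: "complex^'n^'n"
    by (simp add: vec_eq_iff matrix_matrix_mult_def distrib_right sum.distrib)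
  have left: "(r *\<^sub>R A) ** C = r *\<^sub>R (A ** C)" for A C :: "complex^'n^'n" and r
    by (simp add: vec_eq_iff matrix_matrix_mult_def scaleR_sum_right)
  have right: "A ** (r *\<^sub>R C) = r *\<^sub>R (A ** C)" for A C :: "complex^'n^'n" and r
    by (simp add: vec_eq_iff matrix_matrix_mult_def scaleR_sum_right)
  show ?thesis
    unfolding bilinear_conv_bounded_bilinear[symmetric] bilinear_def linear_iff
    by (simp only: add left right matrix_add_ldistrib simp_thms)
qed

text \<open>Bilinearity in finite dimension bounds the norm of a product by the product of the norms
  up to a constant \<open>K\<close>. Powers then grow at most geometrically, and a multiple of the
  exponential series dominates.\<close>

lemma matrix_exp_series_summable:
  fixes M :: "complex^'n^'n"
  shows "summable (\<lambda>n. (1 / fact n) *\<^sub>R matrix_power M n)"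
proof -
  obtain K where K: "0 < K" "\<And>A (B :: complex^'n^'n). norm ((A :: complex^'n^'n) ** B) \<le> norm A * norm B * K"
    using bounded_bilinear.pos_bounded[OF bounded_bilinear_matrix_matrix_mult]
    by blast
  define c where "c = norm M * K"
  define N where "N = norm (mat 1 :: complex^'n^'n)"
  have bound: "norm (matrix_power M n) \<le> N * c ^ n" for n
  proof (induction n)
    case 0
    show ?case by (simp add: N_def)
  next
    case (Suc n)
    have "norm (matrix_power M (Suc n)) \<le> norm M * norm (matrix_power M n) * K"
      using K(2) by simp
    also have "\<dots> = c * norm (matrix_power M n)"
      by (simp add: c_def)
    also have "\<dots> \<le> c * (N * c ^ n)"
      using K(1) by (intro mult_left_mono Suc.IH) (simp add: c_def)
    finally show ?case by (simp add: mult.left_commute)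
  qed
  have "summable (\<lambda>n. N * (inverse (fact n) * c ^ n))"
    by (rule summable_mult[OF summable_exp])
  then show ?thesis
  proof (rule summable_comparison_test'[where N = 0])
    fix n
    have "norm ((1 / fact n) *\<^sub>R matrix_power M n) = inverse (fact n) * norm (matrix_power M n)"
      by (simp add: divide_inverse)
    also have "\<dots> \<le> inverse (fact n) * (N * c ^ n)"
      by (rule mult_left_mono[OF bound]) simp
    finally show "norm ((1 / fact n) *\<^sub>R matrix_power M n) \<le> N * (inverse (fact n) * c ^ n)"
      by (simp add: mult.left_commute)
  qed
qed

lemma matrix_power_eigenvector:
  assumes "M *v x = c *s x"
  shows "matrix_power M n *v x = c ^ n *s x"
  using assms
  by (induction n)
    (simp_all add: matrix_vector_mul_assoc[symmetric] vector_scalar_commute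
      vector_smult_assoc mult.commute)

text \<open>Evaluation at a fixed vector is a continuous linear map of the matrix, so it may be
  applied to the exponential series term by term.\<close>

lemma matrix_exp_eigenvector:
  fixes M :: "complex^'n^'n"
  assumes "M *v x = c *s x"
  shows "matrix_exp M *v x = exp c *s x"
proof -
  have "linear (\<lambda>N :: complex^'n^'n. N *v x)"
    by (simp add: linear_iff matrix_vector_mult_add_rdistrib scaleR_matrix_vector_mult)
  then have "bounded_linear (\<lambda>N :: complex^'n^'n. N *v x)"
    by (simp add: linear_conv_bounded_linear)
  from bounded_linear.sums[OF this summable_sums[OF matrix_exp_series_summable[of M]]]
  have 1: "(\<lambda>n. (1 / fact n) *\<^sub>R (c ^ n *s x)) sums (matrix_exp M *v x)"
    by (simp add: matrix_exp_def scaleR_matrix_vector_mult matrix_power_eigenvector[OF assms])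
  have "linear (\<lambda>z :: complex. z *s x)"
    by (simp add: linear_iff vec_eq_iff algebra_simps)
  then have "bounded_linear (\<lambda>z :: complex. z *s x)"
    by (simp add: linear_conv_bounded_linear)
  from bounded_linear.sums[OF this exp_converges[of c]]
  have 2: "(\<lambda>n. (c ^ n /\<^sub>R fact n) *s x) sums (exp c *s x)" .
  have "(\<lambda>n. (1 / fact n) *\<^sub>R (c ^ n *s x)) = (\<lambda>n. (c ^ n /\<^sub>R fact n) *s x)"
    by (simp add: fun_eq_iff vec_eq_iff inverse_eq_divide)
  with 1 2 show ?thesis by (metis sums_unique2)
qed

text \<open>The vectors x + R x and x - R x satisfy the eigenvalue equations of R for 1 and -1, and
  x is half their sum. The involution is assumed at the single vector x, since P_d(A) is shown to be
  an involution only on the stratification subspace.\<close>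

lemma matrix_exp_involution:
  fixes R :: "complex^'n^'n"
  assumes "R *v (R *v x) = x"
  shows "matrix_exp (map_matrix (\<lambda>z. c * z) R) *v x = cosh c *s x + sinh c *s (R *v x)"
proof -
  let ?M = "map_matrix (\<lambda>z. c * z) R"
  have M: "?M *v y = c *s (R *v y)" for y
    by (simp add: vec_eq_iff matrix_vector_mult_def sum_distrib_left mult.assoc)
  have 1: "matrix_exp ?M *v (x + R *v x) = exp c *s (x + R *v x)"
    by (rule matrix_exp_eigenvector)
      (simp add: M matrix_vector_right_distrib assms add.commute)
  have 2: "matrix_exp ?M *v (x - R *v x) = exp (- c) *s (x - R *v x)"
    by (rule matrix_exp_eigenvector)
      (simp add: M matrix_vector_mult_diff_distrib assms vector_ssub_ldistrib)
  have combine: "(1/2) *s (p *s (x + y) + q *s (x - y)) = ((p + q) / 2) *s x + ((p - q) / 2) *s y"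
    for p q and y :: "complex^'n"
    by (simp add: vec_eq_iff field_simps)
  have "matrix_exp ?M *v x = matrix_exp ?M *v ((1/2) *s ((x + R *v x) + (x - R *v x)))"
    by (rule arg_cong[where f = "\<lambda>y. matrix_exp ?M *v y"]) (simp add: vec_eq_iff)
  also have "\<dots> = (1/2) *s (exp c *s (x + R *v x) + exp (- c) *s (x - R *v x))"
    \<comment> \<open>The instantiation splits only the outer sum, so that both eigenvectors stay
      intact for \<open>1\<close> and \<open>2\<close>.\<close>
    by (simp only: vector_scalar_commute matrix_vector_right_distrib[of _ "x + R *v x"] 1 2)
  also have "\<dots> = ((exp c + exp (- c)) / 2) *s x + ((exp c - exp (- c)) / 2) *s (R *v x)"
    using combine .
  finally show ?thesis
    by (simp only: cosh_field_def sinh_field_def)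
qed

section \<open>Stratum states\<close>

lemma stratum_state_nth:
  "stratum_state E u i $ x =
     (if x \<in> stratum E u i then complex_of_real (1 / sqrt (card (stratum E u i))) else 0)"
  by (simp add: stratum_state_def axis_def if_distrib sum.If_cases cong: if_cong)

lemma card_stratum_pos: "x \<in> stratum E (u :: 'v::finite) i \<Longrightarrow> 0 < card (stratum E u i)"
  by (auto simp: card_gt_0_iff)

text \<open>Compare coordinates at x in the recurrence for A phi_(i+1). On the right only the phi_i
  term reaches x, and it is nonzero because \<omega>_(i+1) > 0; the left side collects the
  neighbours of x in the next stratum.\<close>

lemma szego_jacobi_neighbour_above:
  assumes sj: "szego_jacobi E u \<omega> \<alpha>" and i: "i < largest_dist E u" and x: "x \<in> stratum E u i"
  shows "\<exists>y \<in> stratum E u (Suc i). E x y"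
proof (rule ccontr)
  assume no: "\<not> ?thesis"
  have "(adjacency_matrix E *v stratum_state E u (Suc i)) $ x = 0"
    using no
    by (auto simp: matrix_vector_mult_def adjacency_matrix_def stratum_state_nth intro!: sum.neutral)
  moreover have "x \<notin> stratum E u (Suc i)" "x \<notin> stratum E u (Suc (Suc i))"
    using x by (auto simp: stratum_def)
  then have "(adjacency_matrix E *v stratum_state E u (Suc i)) $ x
      = complex_of_real (sqrt (\<omega> (Suc i)) / sqrt (card (stratum E u i)))"
    using sj i x unfolding szego_jacobi_def
    by (simp add: stratum_state_nth)
  moreover have "0 < \<omega> (Suc i)"
    using sj i by (simp add: szego_jacobi_def)
  ultimately show False
    using card_stratum_pos[OF x] by simp
qed

section \<open>Associated polynomials: stratum states and eigenvectors from the three-term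
  recurrence\<close>

lemma monic_poly_stratum_state:
  assumes sj: "szego_jacobi E u \<omega> \<alpha>" and i: "i \<le> largest_dist E u"
  shows "matrix_poly (monic_poly \<omega> \<alpha> i) (adjacency_matrix E) *v stratum_state E u 0
       = sqrt (\<Prod>j=1..i. \<omega> j) *\<^sub>R stratum_state E u i"
proof -
  have A: "adjacency_matrix E *v stratum_state E u k =
      sqrt (\<omega> (Suc k)) *\<^sub>R stratum_state E u (Suc k) + \<alpha> k *\<^sub>R stratum_state E u k +
      (if 0 < k then sqrt (\<omega> k) *\<^sub>R stratum_state E u (k - 1) else 0)"
    if "k < largest_dist E u" for k
    using sj that by (simp add: szego_jacobi_def of_real_smult_vec)
  show ?thesis
    using i
  proof (induction i rule: induct_nat_012)
    case 0
    then show ?case by (simp add: one_pCons matrix_poly_pCons matrix_poly_0)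
  next
    case 1
    then show ?case by (simp add: matrix_poly_pCons matrix_poly_0 A)
  next
    case (ge2 i)
    let ?p = "\<lambda>k. \<Prod>j=1..k. \<omega> j"
    have p: "?p (Suc k) = ?p k * \<omega> (Suc k)" for k
      by simp
    have pos: "0 < \<omega> (Suc i)"
      using sj ge2.prems by (simp add: szego_jacobi_def)
    \<comment> \<open>The right-hand side is the coefficient with which A phi_(i+1) contributes to
      phi_i, so the subtracted lower polynomial cancels that contribution exactly.\<close>
    have "\<omega> (Suc i) * sqrt (?p i) = sqrt (?p (Suc i)) * sqrt (\<omega> (Suc i))"
      unfolding p using pos by (simp add: real_sqrt_mult)
    moreover have "sqrt (?p (Suc (Suc i))) = sqrt (?p (Suc i)) * sqrt (\<omega> (Suc (Suc i)))"
      unfolding p[of "Suc i"] by (rule real_sqrt_mult)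
    moreover have "matrix_poly (monic_poly \<omega> \<alpha> (Suc (Suc i))) (adjacency_matrix E) *v stratum_state E u 0
        = sqrt (?p (Suc i)) *\<^sub>R (adjacency_matrix E *v stratum_state E u (Suc i))
          - (sqrt (?p (Suc i)) * \<alpha> (Suc i)) *\<^sub>R stratum_state E u (Suc i)
          - (\<omega> (Suc i) * sqrt (?p i)) *\<^sub>R stratum_state E u i"
      using ge2 unfolding monic_poly.simps matrix_poly_diff matrix_poly_mult matrix_poly_smult
      by (simp add: matrix_poly_pCons matrix_poly_0 matrix_vector_mult_scaleR_right mult.commute
          scaleR_diff_right          del: prod.cl_ivl_Suc)
    ultimately show ?case
      using A[of "Suc i"] ge2.prems by (simp add: scaleR_right_distrib del: prod.cl_ivl_Suc monic_poly.simps)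
  qed
qed

lemma prod_szego_jacobi_pos:
  assumes "szego_jacobi E u \<omega> \<alpha>" "i \<le> largest_dist E u"
  shows "0 < (\<Prod>j=1..i. \<omega> j)"
  using assms by (intro prod_pos) (simp add: szego_jacobi_def)

lemma normalized_poly_stratum_state:
  assumes "szego_jacobi E u \<omega> \<alpha>" "i \<le> largest_dist E u"
  shows "matrix_poly (normalized_poly \<omega> \<alpha> i) (adjacency_matrix E) *v stratum_state E u 0
       = stratum_state E u i"
  using prod_szego_jacobi_pos[OF assms]
  by (simp add: normalized_poly_def matrix_poly_smult monic_poly_stratum_state[OF assms]
      less_imp_neq[symmetric] del: prod_zero_iff)

text \<open>A acts tridiagonally and symmetrically on the stratum states, so the eigenvalue equation
  for coefficients P_i(a) is the three-term recurrence; a being a root is the boundary condition in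
  the last stratum.\<close>

lemma root_eigenvector:
  assumes sj: "szego_jacobi E u \<omega> \<alpha>" and d: "d = largest_dist E u"
    and root: "poly (monic_poly \<omega> \<alpha> (Suc d)) a = 0"
  defines "v \<equiv> \<Sum>i\<le>d. poly (normalized_poly \<omega> \<alpha> i) a *\<^sub>R stratum_state E u i"
  shows "adjacency_matrix E *v v = complex_of_real a *s v"
proof -
  let ?A = "adjacency_matrix E" and ?P = "\<lambda>i. poly (normalized_poly \<omega> \<alpha> i) a"
    and ?\<phi> = "stratum_state E u"
  have A: "?A *v ?\<phi> k =
      (if k < d then sqrt (\<omega> (Suc k)) *\<^sub>R ?\<phi> (Suc k) else 0) + \<alpha> k *\<^sub>R ?\<phi> k +
      (if 0 < k then sqrt (\<omega> k) *\<^sub>R ?\<phi> (k - 1) else 0)"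
    if "k \<le> d" for k
    using sj that by (simp add: szego_jacobi_def of_real_smult_vec d)
  have pos: "0 < \<omega> i" if "0 < i" "i \<le> d" for i
    using sj that by (simp add: szego_jacobi_def d)
  have prodpos: "0 < (\<Prod>j=1..i. \<omega> j)" if "i \<le> d" for i
    using prod_szego_jacobi_pos[OF sj] that d by simp
  \<comment> \<open>Dividing by the product up to i only, and not up to i + 1, lets i = d be
    included: \<omega>_(d+1) is unconstrained.\<close>
  have rec: "poly (monic_poly \<omega> \<alpha> (Suc i)) a / sqrt (\<Prod>j=1..i. \<omega> j) =
      (a - \<alpha> i) * ?P i - (if 0 < i then sqrt (\<omega> i) * ?P (i - 1) else 0)" if "i \<le> d" for i
  proof (cases i)
    case 0
    then show ?thesis by (simp add: normalized_poly_def)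
  next
    case (Suc k)
    define w where "w = sqrt (\<omega> i)"
    define s where "s = sqrt (\<Prod>j=1..k. \<omega> j)"
    have "0 < w" "\<omega> i = w * w" "0 < s"
      using pos[of i] prodpos[of k] that Suc by (simp_all add: w_def s_def)
    moreover have "sqrt (\<Prod>j=1..i. \<omega> j) = s * w"
      by (simp add: Suc s_def w_def real_sqrt_mult mult.commute)
    ultimately have "poly (monic_poly \<omega> \<alpha> (Suc i)) a / sqrt (\<Prod>j=1..i. \<omega> j) =
        (a - \<alpha> i) * ?P i - w * (poly (monic_poly \<omega> \<alpha> k) a / s)"
      by (simp add: Suc normalized_poly_def field_simps del: prod.cl_ivl_Suc)
    then show ?thesis
      by (simp add: Suc normalized_poly_def s_def w_def)
  qed
  have step: "sqrt (\<omega> (Suc i)) * ?P (Suc i) =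
      (a - \<alpha> i) * ?P i - (if 0 < i then sqrt (\<omega> i) * ?P (i - 1) else 0)" if "i < d" for i
    unfolding rec[OF less_imp_le[OF that], symmetric] using pos[of "Suc i"] that
    by (simp add: normalized_poly_def real_sqrt_mult)
  have last: "(a - \<alpha> d) * ?P d - (if 0 < d then sqrt (\<omega> d) * ?P (d - 1) else 0) = 0"
    using rec[of d] root by simp
  \<comment> \<open>Christoffel--Darboux: all terms of the partial sum cancel except those at the boundary.\<close>
  have "?A *v (\<Sum>i<k. ?P i *\<^sub>R ?\<phi> i) = a *\<^sub>R (\<Sum>i<k. ?P i *\<^sub>R ?\<phi> i) +
      (if 0 < k then sqrt (\<omega> k) *\<^sub>R (?P (k - 1) *\<^sub>R ?\<phi> k - ?P k *\<^sub>R ?\<phi> (k - 1)) else 0)"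
    if "k \<le> d" for k
    using that
  proof (induction k)
    case (Suc k)
    have "sqrt (\<omega> (Suc k)) *\<^sub>R ?P (Suc k) *\<^sub>R ?\<phi> k =
        ((a - \<alpha> k) * ?P k - (if 0 < k then sqrt (\<omega> k) * ?P (k - 1) else 0)) *\<^sub>R ?\<phi> k"
      using step[of k] Suc.prems by simp
    with Suc show ?case
      by (cases "k = 0")
        (simp_all add: matrix_vector_right_distrib matrix_vector_mult_scaleR_right A
          algebra_simps)
  qed simp
  \<comment> \<open>Adding the term i = d to the partial sum for k = d cancels the phi_(d-1) parts;
    \<open>last\<close> settles the remaining multiple of phi_d.\<close>
  from this[of d]
  have "?A *v v = a *\<^sub>R v"
    using arg_cong[OF last, of "\<lambda>r. r *\<^sub>R ?\<phi> d"]
    unfolding v_def lessThan_Suc_atMost[symmetric]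
    by (cases "d = 0", force simp: matrix_vector_mult_scaleR_right A)
       (simp add: matrix_vector_right_distrib matrix_vector_mult_scaleR_right A algebra_simps)
  then show ?thesis by (simp add: of_real_smult_vec)
qed

section \<open>Distances in an antipodal graph\<close>

lemma relpowp_graph_dist:
  assumes "simple_connected_graph E"
  shows "(E ^^ graph_dist E x y) x y"
proof -
  have "\<exists>n. (E ^^ n) x y"
    using assms by (simp add: simple_connected_graph_def rtranclp_imp_relpowp)
  then show ?thesis
    unfolding graph_dist_def by (rule LeastI_ex)
qed

lemma graph_dist_le: "(E ^^ n) x y \<Longrightarrow> graph_dist E x y \<le> n"
  by (simp add: graph_dist_def Least_le)

lemma relpowp_sym: "symp E \<Longrightarrow> (E ^^ n) x y \<Longrightarrow> (E ^^ n) y x"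
proof (induction n arbitrary: y)
  case (Suc n)
  from Suc.prems(2) obtain z where "(E ^^ n) x z" "E z y"
    by (rule relpowp_Suc_E)
  then show ?case
    using Suc.IH[OF Suc.prems(1)] sympD[OF Suc.prems(1)] by (intro relpowp_Suc_I2)
qed simp

lemma graph_dist_triangle:
  assumes "simple_connected_graph E"
  shows "graph_dist E x z \<le> graph_dist E x y + graph_dist E y z"
  by (rule graph_dist_le[OF relpowp_trans[OF relpowp_graph_dist relpowp_graph_dist]]) (rule assms)+

lemma graph_dist_sym:
  assumes "simple_connected_graph E"
  shows "graph_dist E x y = graph_dist E y x"
proof -
  have "graph_dist E a b \<le> graph_dist E b a" for a b
    using assms by (intro graph_dist_le[OF relpowp_sym[OF _ relpowp_graph_dist]])
      (simp_all add: simple_connected_graph_def)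
  then show ?thesis by (simp add: antisym)
qed

lemma graph_dist_self: "graph_dist E x x = 0"
  using graph_dist_le[of 0 E x x] by simp

lemma graph_dist_le_largest: "graph_dist E (u :: 'v::finite) y \<le> largest_dist E u"
  by (simp add: largest_dist_def)

lemma stratum_0:
  assumes "simple_connected_graph E"
  shows "stratum E u 0 = {u}"
proof -
  have "y = u" if "graph_dist E u y = 0" for y
    using relpowp_graph_dist[OF assms, of u y] that by simp
  then show ?thesis
    by (auto simp: stratum_def graph_dist_self)
qed

lemma stratum_state_singleton: "stratum E u i = {x} \<Longrightarrow> stratum_state E u i = ket x"
  by (simp add: stratum_state_def)

text \<open>Climbing one stratum at a time from y must end in the single vertex u', which bounds the
  distance from y to u' above; the triangle inequality gives the reverse bound.\<close>

lemma graph_dist_antipode: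
  assumes G: "simple_connected_graph E" and sj: "szego_jacobi E u \<omega> \<alpha>"
    and anti: "stratum E u (largest_dist E u) = {u'}"
  shows "graph_dist E u y + graph_dist E u' y = largest_dist E u"
proof -
  let ?d = "largest_dist E u"
  have "(E ^^ n) y u'" if "graph_dist E u y + n = ?d" for n y
    using that
  proof (induction n arbitrary: y)
    case 0
    then have "y \<in> stratum E u ?d" by (simp add: stratum_def)
    then show ?case using anti by simp
  next
    case (Suc n)
    then obtain z where "E y z" "graph_dist E u z = Suc (graph_dist E u y)"
      using szego_jacobi_neighbour_above[OF sj, of "graph_dist E u y" y] by (auto simp: stratum_def)
    with Suc show ?case by (intro relpowp_Suc_I2[of E y z]) simp_all
  qed
  from this[of y "?d - graph_dist E u y"]
  have "graph_dist E y u' \<le> ?d - graph_dist E u y"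
    using graph_dist_le_largest[of E u y] by (simp add: graph_dist_le)
  moreover have "graph_dist E u u' = ?d"
    using anti by (auto simp: stratum_def)
  ultimately show ?thesis
    using graph_dist_triangle[OF G, of u u' y] graph_dist_le_largest[of E u y]
    by (simp add: graph_dist_sym[OF G, of u' y])
qed

section \<open>The operator R = P_d(A): involution, eigenvalues and time evolution\<close>

theorem mainTheorem3:
  fixes E :: "'v::finite \<Rightarrow> 'v \<Rightarrow> bool" and u u' :: 'v and d :: nat
    and \<omega> \<alpha> \<omega>' \<alpha>' :: "nat \<Rightarrow> real"
  assumes "d = largest_dist E u" and "1 \<le> d"
    and "reflective_antipodal_isg E u u' \<omega> \<alpha> \<omega>' \<alpha>'"
  shows "(\<forall>v\<in>strat_space E u.
            matrix_power (matrix_poly (normalized_poly \<omega> \<alpha> d) (adjacency_matrix E)) 2 *v v = v) \<and>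
         (\<forall>a. poly (monic_poly \<omega> \<alpha> (d + 1)) a = 0 \<or>
               is_eigenvalue_on (adjacency_matrix E) (strat_space E u) (complex_of_real a) \<longrightarrow>
            poly (normalized_poly \<omega> \<alpha> d) a \<in> {1, - 1}) \<and>
         (\<exists>(f :: real poly) (t :: real). 0 < t \<and>
            concurrence
              (matrix_exp (map_matrix (\<lambda>z. - \<i> * complex_of_real t * z)
                 (matrix_poly f (adjacency_matrix E))) *v ket u) u u' = 1)"
proof -
  let ?A = "adjacency_matrix E" and ?P = "normalized_poly \<omega> \<alpha>" and ?\<phi> = "stratum_state E u"
  define R where "R = matrix_poly (?P d) ?A"
  note d = assms(1)
  have G: "simple_connected_graph E" and anti: "stratum E u d = {u'}"
    and sj: "szego_jacobi E u \<omega> \<alpha>" and sj': "szego_jacobi E u' \<omega>' \<alpha>'"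
    and \<omega>: "\<And>i. 1 \<le> i \<Longrightarrow> i \<le> d \<Longrightarrow> \<omega>' i = \<omega> i" and \<alpha>: "\<And>i. i \<le> d \<Longrightarrow> \<alpha>' i = \<alpha> i"
    using assms(3) by (simp_all add: reflective_antipodal_isg_def antipodal_isg_def isg_def d)
  have dist: "graph_dist E u y + graph_dist E u' y = d" for y
    using graph_dist_antipode[OF G sj] anti d by simp
  have le': "graph_dist E u' y \<le> d" for y
    using dist[of y] by linarith
  moreover have "graph_dist E u' u = d"
    using dist[of u] by (simp add: graph_dist_self)
  ultimately have d': "largest_dist E u' = d"
    unfolding largest_dist_def by (intro Max_eqI) auto
  have "stratum E u' i = stratum E u (d - i)" if "i \<le> d" for i
  proof -
    have "graph_dist E u' y = i \<longleftrightarrow> graph_dist E u y = d - i" for y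
      using dist[of y] that by linarith
    then show ?thesis by (simp add: stratum_def)
  qed
  then have \<phi>': "stratum_state E u' i = ?\<phi> (d - i)" if "i \<le> d" for i
    using that by (simp add: stratum_state_def)
  \<comment> \<open>Reflectivity enters here: the same polynomials P_i now serve around both u and
    u'.\<close>
  have sj_anti: "szego_jacobi E u' \<omega> \<alpha>"
    using sj' unfolding szego_jacobi_def d' by (simp add: \<omega> \<alpha>)
  have \<phi>0: "?\<phi> 0 = ket u" and \<phi>d: "?\<phi> d = ket u'"
    using stratum_0[OF G] anti by (simp_all add: stratum_state_singleton)
  have R0: "R *v ?\<phi> 0 = ?\<phi> d"
    using normalized_poly_stratum_state[OF sj, of d] by (simp add: R_def d)
  \<comment> \<open>Around u' the strata are reversed, so phi_d is the initial state there and phi_0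
    the final one.\<close>
  have Rd: "R *v ?\<phi> d = ?\<phi> 0"
    using normalized_poly_stratum_state[OF sj_anti, of d] by (simp add: R_def d' \<phi>')
  have R_commute: "R *v (matrix_poly p ?A *v x) = matrix_poly p ?A *v (R *v x)" for p x
    unfolding R_def matrix_poly_mult[symmetric] by (simp add: mult.commute)
  \<comment> \<open>Move P_i(A) to the front of both copies of R; what is left is R R phi_0 = R
    phi_d = phi_0.\<close>
  have R\<phi>: "R *v (R *v ?\<phi> i) = ?\<phi> i" if "i \<le> d" for i
  proof -
    have "?\<phi> i = matrix_poly (?P i) ?A *v ?\<phi> 0"
      using normalized_poly_stratum_state[OF sj, of i] that d by simp
    then show ?thesis by (simp add: R_commute R0 Rd)
  qed
  have RR: "R *v (R *v v) = v" if "v \<in> strat_space E u" for v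
    using that unfolding strat_space_def
  proof (induction rule: vec.span_induct_alt)
    case (step c x y)
    then show ?case
      by (auto simp: matrix_vector_right_distrib vector_scalar_commute R\<phi> d)
  qed simp
  have sq: "matrix_power R 2 *v v = v" if "v \<in> strat_space E u" for v
    using RR[OF that] by (simp add: numeral_2_eq_2 matrix_vector_mul_assoc)
  have eig: "poly (?P d) a \<in> {1, -1}"
    if "v \<in> strat_space E u" "v \<noteq> 0" "?A *v v = complex_of_real a *s v" for a v
  proof -
    have "R *v v = poly (?P d) a *\<^sub>R v"
      unfolding R_def by (rule matrix_poly_eigenvector) (rule that(3))
    then have "(poly (?P d) a * poly (?P d) a) *\<^sub>R v = 1 *\<^sub>R v"
      using RR[OF that(1)] by (simp add: matrix_vector_mult_scaleR_right)
    \<comment> \<open>A nonzero vector fixed by R R forces the square of its R-eigenvalue to be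
      1.\<close>
    then have "poly (?P d) a * poly (?P d) a = 1"
      using that(2) by (simp only: scaleR_right_imp_eq)
    then show ?thesis
      by (simp add: square_eq_1_iff)
  qed
  have root: "poly (?P d) a \<in> {1, -1}" if a: "poly (monic_poly \<omega> \<alpha> (d + 1)) a = 0" for a
  proof -
    let ?v = "\<Sum>i\<le>d. poly (?P i) a *\<^sub>R ?\<phi> i"
    have "?A *v ?v = complex_of_real a *s ?v"
      using root_eigenvector[OF sj d] a by simp
    moreover have "?v \<in> strat_space E u"
      unfolding strat_space_def of_real_smult_vec[symmetric]
      by (intro vec.span_sum vec.span_scale vec.span_base) (auto simp: d)
    \<comment> \<open>Among the stratum states only phi_0 is supported at u, and its coefficient is
      P_0(a) = 1; hence the eigenvector is nonzero.\<close>
    moreover have \<phi>_u: "?\<phi> i $ u = (if i = 0 then 1 else 0)" for i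
      using \<phi>0 by (cases i) (simp_all add: stratum_state_nth stratum_def graph_dist_self)
    have "?v $ u = 1"
      by (simp add: \<phi>_u if_distrib normalized_poly_def cong: if_cong)
    then have "?v \<noteq> 0"
      by (metis zero_index zero_neq_one)
    ultimately show ?thesis using eig by blast
  qed
  \<comment> \<open>At time pi/4 sine and cosine agree, so the amplitudes at u and u' both have
    modulus 1 / sqrt 2.\<close>
  let ?c = "- \<i> * complex_of_real (pi / 4)"
  let ?s = "matrix_exp (map_matrix (\<lambda>z. ?c * z) R) *v ket u"
  \<comment> \<open>The hyperbolic functions are trigonometric ones at \<i> times the argument,
    which here is real.\<close>
  have "\<i> * ?c = complex_of_real (pi / 4)"
    by simp
  then have c: "cosh ?c = complex_of_real (cos (pi / 4))"
      "sinh ?c = - \<i> * complex_of_real (sin (pi / 4))"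
    by (simp_all only: cosh_conv_cos sinh_conv_sin cos_of_real sin_of_real)
  have s: "?s = cosh ?c *s ket u + sinh ?c *s ket u'"
    using matrix_exp_involution[of R "ket u" ?c] R0 Rd unfolding \<phi>0 \<phi>d by simp
  \<comment> \<open>This uses d \<ge> 1: coinciding endpoints would give d = 0.\<close>
  have "u \<noteq> u'"
    using dist[of u] assms(2) by (auto simp: graph_dist_self)
  then have "?s $ u = complex_of_real (cos (pi / 4))" "?s $ u' = - \<i> * complex_of_real (sin (pi / 4))"
    unfolding s c by (simp_all add: axis_def)
  then have "concurrence ?s u u' = 2 * (\<bar>cos (pi / 4)\<bar> * \<bar>sin (pi / 4)\<bar>)"
    by (simp only: concurrence_def norm_mult norm_of_real norm_minus_cancel norm_ii mult_1_left)
  also have "\<dots> = 1"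
    by (simp add: cos_45 sin_45)
  finally have "concurrence ?s u u' = 1" .
  then show ?thesis
    using sq eig root unfolding R_def is_eigenvalue_on_def
    by (intro conjI ballI allI impI exI[of _ "?P d"] exI[of _ "pi / 4"]) auto
qed

end
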